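(* Let $X>0$, let $E_1,\ldots,E_N$ be trading functions on $[0,X]$ with $0<\mu\le -E_i''(x)\le L$ for all $i$ and all $x\in[0,X]$, let $\kappa=L/\mu$, and let $\mathbf{x}^{(0)},\mathbf{x}^{(1)},\ldots$ be the allocations produced by the transfer algorithm (started from a greedy initialization). Write $h^{(k)}=F(\mathbf{x}^* )-F(\mathbf{x}^{(k)})$ for the objective gap after $k$ rounds. Then for every $k\ge 0$, $$h^{(k+1)}\le\left(1-\frac{3}{32\kappa N}\right)^{k+1}h^{(0)}.$$ Moreover, the objective gap is at most $\varepsilon$ after $\mathcal{O}\left(N\kappa\log\frac{1}{\varepsilon}\right)$ rounds; that is, there is a constant $C$ depending only on $h^{(0)}$ such that for every $\varepsilon\in(0,\tfrac12]$ one has $h^{(k)}\le\varepsilon$ for all integers $k\ge C\,N\kappa\log\frac1\varepsilon$.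
   Context: Problem. A total amount $X>0$ of an input token is to be split among $N$ automated market makers (pools). Pool $i$ has a trading function $E_i:[0,X]\to[0,\infty)$, which is non-negative, increasing, concave and twice continuously differentiable, with $E_i'>0$; $E_i(x_i)$ is the output obtained from selling $x_i$ to pool $i$. The price in pool $i$ after selling $x_i$ is $P_i(x_i)=1/E_i'(x_i)$. The problem is to maximize $F(\mathbf{x})=\sum_{i=1}^N E_i(x_i)$ subject to $x_i\ge 0$ and $\sum_{i=1}^N x_i=X$; $\mathbf{x}^*$ denotes the maximizer. There are constants $0<\mu\le L$ with $\mu\le -E_i''(x)\le L$ for all $i$ and $x\in[0,X]$; the liquidity heterogeneity is $\kappa=L/\mu$. Transfer algorithm. Given the current feasible allocation $\mathbf{x}$, the donor is a pool $D\in\arg\max_{i:\,x_i>0}P_i(x_i)$ (i.e. with smallest $E_i'(x_i)$ among pools with $x_i>0$) and the receiver is a pool $R\in\arg\min_i P_i(x_i)$ (i.e. with largest $E_i'(x_i)$ among all pools), ties broken arbitrarily. The donor-receiver gap is $g_{\mathbf{x}}=E_R'(x_R)-E_D'(x_D)$. If $g_{\mathbf{x}}>0$, a round transfers an amount $\delta$ from $D$ to $R$, i.e. $x_D$ is replaced by $x_D-\delta$ and $x_R$ by $x_R+\delta$, the other coordinates being unchanged. A transfer of $\delta$ is legitimate if after it $P_R\le P_D$, i.e. $E_R'(x_R+\delta)\ge E_D'(x_D-\delta)$. The amount $\delta$ is found by halving: it is the first of $x_D/2,x_D/4,x_D/8,\ldots$ that is legitimate. If $g_{\mathbf{x}}=0$,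 the allocation is left unchanged in all subsequent rounds. (The rounds are considered without any further stopping threshold.) $\mathbf{x}^{(k)}$ is the allocation after $k$ rounds. Greedy initialization. The initial allocation $\mathbf{x}^{(0)}$ is obtained from the zero vector by allocating the total amount $X$ in finitely many successive positive portions, each portion going entirely to a pool whose current $E_i'(x_i)$ is largest among all pools; the simplest case allocates all of $X$ at once to a pool with the best initial price (largest $E_i'(0)$). *)

theory Defs
  imports "HOL-Analysis.Analysis"
begin

text \<open>
  Pools are indexed by the natural numbers below \<open>N\<close>, and an allocation is a function
  \<open>nat \<Rightarrow> real\<close> of which only the values at indices below \<open>N\<close> matter.
  Trading functions live on the interval from \<open>0\<close> to \<open>X\<close>, so derivatives are taken within
  that interval, i.e. they are one-sided at the end points.
\<close>

definition deriv_on :: "real \<Rightarrow> (real \<Rightarrow> real) \<Rightarrow> real \<Rightarrow> real" where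
  "deriv_on X f t = vector_derivative f (at t within {0..X})"

definition deriv2_on :: "real \<Rightarrow> (real \<Rightarrow> real) \<Rightarrow> real \<Rightarrow> real" where
  "deriv2_on X f = deriv_on X (deriv_on X f)"

definition trading_function :: "real \<Rightarrow> (real \<Rightarrow> real) \<Rightarrow> bool" where
  "trading_function X f \<longleftrightarrow>
     (\<forall>t\<in>{0..X}. 0 \<le> f t) \<and>
     mono_on {0..X} f \<and>
     concave_on {0..X} f \<and>
     f differentiable_on {0..X} \<and>
     deriv_on X f differentiable_on {0..X} \<and>
     continuous_on {0..X} (deriv2_on X f) \<and>
     (\<forall>t\<in>{0..X}. 0 < deriv_on X f t)"

definition price :: "real \<Rightarrow> (real \<Rightarrow> real) \<Rightarrow> real \<Rightarrow> real" where
  "price X f t = 1 / deriv_on X f t"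

definition feasible :: "nat \<Rightarrow> real \<Rightarrow> (nat \<Rightarrow> real) \<Rightarrow> bool" where
  "feasible N X x \<longleftrightarrow> (\<forall>i<N. 0 \<le> x i) \<and> (\<Sum>i<N. x i) = X"

definition objective :: "nat \<Rightarrow> (nat \<Rightarrow> real \<Rightarrow> real) \<Rightarrow> (nat \<Rightarrow> real) \<Rightarrow> real" where
  "objective N E x = (\<Sum>i<N. E i (x i))"

definition is_donor ::
  "nat \<Rightarrow> real \<Rightarrow> (nat \<Rightarrow> real \<Rightarrow> real) \<Rightarrow> (nat \<Rightarrow> real) \<Rightarrow> nat \<Rightarrow> bool" where
  "is_donor N X E x D \<longleftrightarrow>
     is_arg_max (\<lambda>i. price X (E i) (x i)) (\<lambda>i. i < N \<and> 0 < x i) D"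

definition is_receiver ::
  "nat \<Rightarrow> real \<Rightarrow> (nat \<Rightarrow> real \<Rightarrow> real) \<Rightarrow> (nat \<Rightarrow> real) \<Rightarrow> nat \<Rightarrow> bool" where
  "is_receiver N X E x R \<longleftrightarrow>
     is_arg_min (\<lambda>i. price X (E i) (x i)) (\<lambda>i. i < N) R"

definition gap ::
  "real \<Rightarrow> (nat \<Rightarrow> real \<Rightarrow> real) \<Rightarrow> (nat \<Rightarrow> real) \<Rightarrow> nat \<Rightarrow> nat \<Rightarrow> real" where
  "gap X E x D R = deriv_on X (E R) (x R) - deriv_on X (E D) (x D)"

definition transfer :: "(nat \<Rightarrow> real) \<Rightarrow> nat \<Rightarrow> nat \<Rightarrow> real \<Rightarrow> nat \<Rightarrow> real" where
  "transfer x D R \<delta> = x(D := x D - \<delta>, R := x R + \<delta>)"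

definition legitimate ::
  "real \<Rightarrow> (nat \<Rightarrow> real \<Rightarrow> real) \<Rightarrow> (nat \<Rightarrow> real) \<Rightarrow> nat \<Rightarrow> nat \<Rightarrow> real \<Rightarrow> bool" where
  "legitimate X E x D R \<delta> \<longleftrightarrow>
     price X (E R) (x R + \<delta>) \<le> price X (E D) (x D - \<delta>)"

definition halving_amount ::
  "real \<Rightarrow> (nat \<Rightarrow> real \<Rightarrow> real) \<Rightarrow> (nat \<Rightarrow> real) \<Rightarrow> nat \<Rightarrow> nat \<Rightarrow> real \<Rightarrow> bool" where
  "halving_amount X E x D R \<delta> \<longleftrightarrow>
     (\<exists>m\<ge>1. \<delta> = x D / 2 ^ m \<and> legitimate X E x D R \<delta> \<and>
        (\<forall>j. 1 \<le> j \<and> j < m \<longrightarrow> \<not> legitimate X E x D R (x D / 2 ^ j)))"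

text \<open>
  A round is a relation, since ties in the choice of donor and receiver are broken arbitrarily.
  The gap does not depend on these choices and is never negative at a feasible allocation,
  so the second branch below is the case of a zero gap.
\<close>

definition transfer_round ::
  "nat \<Rightarrow> real \<Rightarrow> (nat \<Rightarrow> real \<Rightarrow> real) \<Rightarrow> (nat \<Rightarrow> real) \<Rightarrow> (nat \<Rightarrow> real) \<Rightarrow> bool" where
  "transfer_round N X E x x' \<longleftrightarrow>
     (\<exists>D R. is_donor N X E x D \<and> is_receiver N X E x R \<and>
        (if 0 < gap X E x D R
         then \<exists>\<delta>. halving_amount X E x D R \<delta> \<and> x' = transfer x D R \<delta>
         else x' = x))"

inductive greedy_partial ::
  "nat \<Rightarrow> real \<Rightarrow> (nat \<Rightarrow> real \<Rightarrow> real) \<Rightarrow> (nat \<Rightarrow> real) \<Rightarrow> bool"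
  for N X E where
  zero: "greedy_partial N X E (\<lambda>_. 0)"
| portion: "greedy_partial N X E x \<Longrightarrow>
    is_arg_max (\<lambda>j. deriv_on X (E j) (x j)) (\<lambda>j. j < N) i \<Longrightarrow> 0 < \<delta> \<Longrightarrow>
    greedy_partial N X E (x(i := x i + \<delta>))"

text \<open>
  Portions are positive, so the requirement that the final total is \<open>X\<close> also keeps every
  intermediate allocation within the domain of the trading functions.
\<close>

definition greedy_initialization ::
  "nat \<Rightarrow> real \<Rightarrow> (nat \<Rightarrow> real \<Rightarrow> real) \<Rightarrow> (nat \<Rightarrow> real) \<Rightarrow> bool" where
  "greedy_initialization N X E x \<longleftrightarrow> greedy_partial N X E x \<and> (\<Sum>i<N. x i) = X"

definition objective_gap ::
  "nat \<Rightarrow> (nat \<Rightarrow> real \<Rightarrow> real) \<Rightarrow> (nat \<Rightarrow> real) \<Rightarrow> (nat \<Rightarrow> nat \<Rightarrow> real) \<Rightarrow> nat \<Rightarrow> real" where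
  "objective_gap N E xopt x k = objective N E xopt - objective N E (x k)"

end

theory Submission
  imports Defs
begin

text \<open>
  Write \<open>g\<close> for the donor-receiver gap. Comparing every marginal output with that of the
  receiver, \<open>\<mu>\<close>-strong concavity bounds the objective gap by \<open>N g\<^sup>2 / (2\<mu>)\<close>. A greedy
  initialization guarantees that every active pool has an initial marginal output at least as large
  as all current marginal outputs, and the rounds preserve this; hence emptying the donor is never
  legitimate. So twice the transferred amount \<open>\<delta>\<close> always overshoots, which forces
  \<open>\<delta> \<ge> g / (4L)\<close>, and the objective grows by at least \<open>3 g\<^sup>2 / (16 L)\<close>. The two bounds
  give a contraction of the objective gap.
\<close>

section \<open>Curvature bounds for a single pool\<close>

locale curved_pools =
  fixes N :: nat and X :: real and E :: "nat \<Rightarrow> real \<Rightarrow> real" and \<mu> L :: real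
  assumes trading: "i < N \<Longrightarrow> trading_function X (E i)"
    and mu_pos: "0 < \<mu>" and mu_le_L: "\<mu> \<le> L"
    and curvature: "i < N \<Longrightarrow> t \<in> {0..X} \<Longrightarrow>
      \<mu> \<le> - deriv2_on X (E i) t \<and> - deriv2_on X (E i) t \<le> L"
begin

abbreviation marginal :: "nat \<Rightarrow> real \<Rightarrow> real" where
  "marginal i \<equiv> deriv_on X (E i)"

lemma L_pos: "0 < L"
  using mu_pos mu_le_L by linarith

lemma marginal_pos: "i < N \<Longrightarrow> t \<in> {0..X} \<Longrightarrow> 0 < marginal i t"
  using trading by (auto simp: trading_function_def)

lemma has_derivative_pool:
  assumes "i < N" "t \<in> {0..X}"
  shows "(E i has_real_derivative marginal i t) (at t within {0..X})"
  using trading[OF assms(1)] assms(2)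
  by (auto simp: trading_function_def differentiable_on_def deriv_on_def
      has_real_derivative_iff_has_vector_derivative vector_derivative_works[symmetric])

lemma has_derivative_marginal:
  assumes "i < N" "t \<in> {0..X}"
  shows "(marginal i has_real_derivative deriv2_on X (E i) t) (at t within {0..X})"
  using trading[OF assms(1)] assms(2)
  by (auto simp: trading_function_def differentiable_on_def deriv2_on_def deriv_on_def[of X "marginal i"]
      has_real_derivative_iff_has_vector_derivative vector_derivative_works[symmetric])

text \<open>The derivatives at \<open>0\<close> and \<open>X\<close> are one-sided. Restricting them
  to \<open>{a..b}\<close> is enough for the mean value theorem, so the end points need no separate
  treatment.\<close>

lemma mean_value_within:
  fixes f f' :: "real \<Rightarrow> real"
  assumes "\<And>t. t \<in> {0..X} \<Longrightarrow> (f has_real_derivative f' t) (at t within {0..X})"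
    and "0 \<le> a" "a \<le> b" "b \<le> X"
  obtains t where "t \<in> {a..b}" "f b - f a = f' t * (b - a)"
proof -
  have "(f has_derivative (*) (f' t)) (at t within {a..b})" if "a \<le> t" "t \<le> b" for t
    using has_field_derivative_subset[OF assms(1), of t "{a..b}"] that assms(2-)
    by (simp add: has_field_derivative_def)
  from mvt_very_simple[OF \<open>a \<le> b\<close> this] that show thesis
    by auto
qed

text \<open>Mean value theorem for the marginal output. All later estimates use the curvature bounds
  through these two inequalities.\<close>

lemma marginal_decrease:
  assumes "i < N" "0 \<le> a" "a \<le> b" "b \<le> X"
  shows "\<mu> * (b - a) \<le> marginal i a - marginal i b"
    and "marginal i a - marginal i b \<le> L * (b - a)"
proof -
  obtain t where t: "t \<in> {a..b}" "marginal i b - marginal i a = deriv2_on X (E i) t * (b - a)"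
    using mean_value_within[OF has_derivative_marginal[OF assms(1)] assms(2-)] by blast
  have "marginal i a - marginal i b = (- deriv2_on X (E i) t) * (b - a)"
    using t(2) by simp
  moreover have "\<mu> \<le> - deriv2_on X (E i) t" "- deriv2_on X (E i) t \<le> L"
    using curvature[OF assms(1), of t] t(1) assms by auto
  ultimately show "\<mu> * (b - a) \<le> marginal i a - marginal i b"
    and "marginal i a - marginal i b \<le> L * (b - a)"
    using assms(3) by (simp_all only: mult_right_mono diff_ge_0_iff_ge)
qed

lemma marginal_antimono:
  assumes "i < N" "0 \<le> a" "a \<le> b" "b \<le> X"
  shows "marginal i b \<le> marginal i a"
proof -
  have "0 \<le> \<mu> * (b - a)"
    using mu_pos assms(3) by simp
  then show ?thesis
    using marginal_decrease(1)[OF assms] by linarith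
qed

text \<open>The pool minus its linear part at \<open>a\<close>, corrected by a parabola. By
  \<open>marginal_decrease\<close>, for \<open>c = \<mu>\<close> the derivative is nonnegative left
  of \<open>a\<close> and nonpositive right of it; for \<open>c = L\<close> the signs are reversed.
  So \<open>a\<close> is a maximum or a minimum respectively, which yields the upper and lower
  quadratic bounds.\<close>

lemma has_derivative_quadratic_remainder:
  assumes "i < N" "t \<in> {0..X}"
  shows "((\<lambda>t. E i t - marginal i a * (t - a) + c / 2 * (t - a)\<^sup>2) has_real_derivative
           marginal i t - marginal i a + c * (t - a)) (at t within {0..X})"
  by (rule derivative_eq_intros has_derivative_pool[OF assms] refl | simp)+

lemma pool_upper_quadratic:
  assumes "i < N" "a \<in> {0..X}" "b \<in> {0..X}"
  shows "E i b \<le> E i a + marginal i a * (b - a) - \<mu> / 2 * (b - a)\<^sup>2"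
proof (cases "a \<le> b")
  case True
  obtain t where t: "t \<in> {a..b}"
    "E i b - marginal i a * (b - a) + \<mu> / 2 * (b - a)\<^sup>2 - E i a
       = (marginal i t - marginal i a + \<mu> * (t - a)) * (b - a)"
    using mean_value_within[OF has_derivative_quadratic_remainder[OF assms(1), of _ a \<mu>], of a b]
      True assms(2,3) by auto
  have "marginal i t - marginal i a + \<mu> * (t - a) \<le> 0"
    using marginal_decrease(1)[OF assms(1), of a t] t(1) assms(2,3) by auto
  then show ?thesis
    using mult_nonpos_nonneg[of "marginal i t - marginal i a + \<mu> * (t - a)" "b - a"] True t(2)
    by linarith
next
  case False
  then obtain t where t: "t \<in> {b..a}"
    "E i a - (E i b - marginal i a * (b - a) + \<mu> / 2 * (b - a)\<^sup>2)
       = (marginal i t - marginal i a + \<mu> * (t - a)) * (a - b)"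
    using mean_value_within[OF has_derivative_quadratic_remainder[OF assms(1), of _ a \<mu>], of b a]
      assms(2,3) by auto
  have "0 \<le> marginal i t - marginal i a + \<mu> * (t - a)"
    using marginal_decrease(1)[OF assms(1), of t a] t(1) assms(2,3) by (auto simp: algebra_simps)
  then have "0 \<le> (marginal i t - marginal i a + \<mu> * (t - a)) * (a - b)"
    using False by simp
  then show ?thesis
    using t(2) by linarith
qed

lemma pool_upper_linear:
  assumes "i < N" "a \<in> {0..X}" "b \<in> {0..X}"
  shows "E i b \<le> E i a + marginal i a * (b - a)"
proof -
  have "0 \<le> \<mu> / 2 * (b - a)\<^sup>2"
    using mu_pos by simp
  then show ?thesis
    using pool_upper_quadratic[OF assms] by linarith
qed

lemma pool_lower_quadratic:
  assumes "i < N" "a \<in> {0..X}" "b \<in> {0..X}"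
  shows "E i a + marginal i a * (b - a) - L / 2 * (b - a)\<^sup>2 \<le> E i b"
proof (cases "a \<le> b")
  case True
  obtain t where t: "t \<in> {a..b}"
    "E i b - marginal i a * (b - a) + L / 2 * (b - a)\<^sup>2 - E i a
       = (marginal i t - marginal i a + L * (t - a)) * (b - a)"
    using mean_value_within[OF has_derivative_quadratic_remainder[OF assms(1), of _ a L], of a b]
      True assms(2,3) by auto
  have "0 \<le> marginal i t - marginal i a + L * (t - a)"
    using marginal_decrease(2)[OF assms(1), of a t] t(1) assms(2,3) by auto
  then have "0 \<le> (marginal i t - marginal i a + L * (t - a)) * (b - a)"
    using True by simp
  then show ?thesis
    using t(2) by linarith
next
  case False
  then obtain t where t: "t \<in> {b..a}"
    "E i a - (E i b - marginal i a * (b - a) + L / 2 * (b - a)\<^sup>2)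
       = (marginal i t - marginal i a + L * (t - a)) * (a - b)"
    using mean_value_within[OF has_derivative_quadratic_remainder[OF assms(1), of _ a L], of b a]
      assms(2,3) by auto
  have "marginal i t - marginal i a + L * (t - a) \<le> 0"
    using marginal_decrease(2)[OF assms(1), of t a] t(1) assms(2,3) by (auto simp: algebra_simps)
  then show ?thesis
    using mult_nonpos_nonneg[of "marginal i t - marginal i a + L * (t - a)" "a - b"] False t(2)
    by linarith
qed

section \<open>Prices, marginal outputs and feasibility\<close>

text \<open>Prices are reciprocals of marginal outputs, which are positive on the domain, so the
  order reverses. Donor, receiver and legitimacy are handled through marginals from here on.\<close>

lemma price_le_iff:
  assumes "i < N" "j < N" "s \<in> {0..X}" "t \<in> {0..X}"
  shows "price X (E i) s \<le> price X (E j) t \<longleftrightarrow> marginal j t \<le> marginal i s"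
  using marginal_pos[OF assms(1,3)] marginal_pos[OF assms(2,4)]
  by (simp add: price_def field_simps)

text \<open>Keeps the receiver inside the domain even if it takes everything the donor
  holds.\<close>

lemma feasible_add_le:
  assumes "feasible N X x" "i < N" "j < N" "i \<noteq> j"
  shows "x i + x j \<le> X"
proof -
  have "sum x {i, j} \<le> (\<Sum>i<N. x i)"
    using assms by (intro sum_mono2) (auto simp: feasible_def)
  then show ?thesis
    using assms by (simp add: feasible_def)
qed

lemma feasible_in_domain:
  assumes "feasible N X x" "i < N"
  shows "x i \<in> {0..X}"
proof -
  have "sum x {i} \<le> (\<Sum>i<N. x i)"
    using assms by (intro sum_mono2) (auto simp: feasible_def)
  then show ?thesis
    using assms by (simp add: feasible_def)
qed

lemma donor_marginal_le:
  assumes "feasible N X x" "is_donor N X E x D" "i < N" "0 < x i"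
  shows "marginal D (x D) \<le> marginal i (x i)"
proof -
  have "D < N" "price X (E i) (x i) \<le> price X (E D) (x D)"
    using assms(2-) by (auto simp: is_donor_def is_arg_max_def not_less[symmetric])
  then show ?thesis
    using price_le_iff assms(3) feasible_in_domain[OF assms(1)] by blast
qed

lemma receiver_marginal_ge:
  assumes "feasible N X x" "is_receiver N X E x R" "i < N"
  shows "marginal i (x i) \<le> marginal R (x R)"
proof -
  have "R < N" "price X (E R) (x R) \<le> price X (E i) (x i)"
    using assms(2-) by (auto simp: is_receiver_def is_arg_min_def not_less[symmetric])
  then show ?thesis
    using price_le_iff assms(3) feasible_in_domain[OF assms(1)] by blast
qed

section \<open>Objective gap in terms of the donor-receiver gap\<close>

text \<open>Completing the square: the parabola in \<open>y\<close> peaks at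
  \<open>y = a / \<mu>\<close>.\<close>

lemma linear_minus_quadratic_le:
  assumes "\<bar>a\<bar> \<le> g"
  shows "a * y - \<mu> / 2 * y\<^sup>2 \<le> g\<^sup>2 / (2 * \<mu>)"
proof -
  have "0 \<le> (\<mu> * y - a)\<^sup>2"
    by simp
  then have "2 * \<mu> * (a * y - \<mu> / 2 * y\<^sup>2) \<le> a\<^sup>2"
    by (simp add: power2_eq_square algebra_simps)
  also have "a\<^sup>2 \<le> g\<^sup>2"
    using assms by (simp add: abs_le_square_iff[symmetric])
  finally show ?thesis
    using mu_pos by (simp add: field_simps)
qed

text \<open>The receiver's marginal serves as a common multiplier: subtracting it times
  \<open>y i - x i\<close> changes nothing in total, as both allocations sum to \<open>X\<close>,
  and then each pool is bounded separately. Taking \<open>max 0\<close> makes the bound vanish in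
  exactly the branch in which a round leaves the allocation alone.\<close>

lemma objective_diff_le_gap:
  assumes x: "feasible N X x" and y: "feasible N X y"
    and D: "is_donor N X E x D" and R: "is_receiver N X E x R"
  shows "objective N E y - objective N E x \<le> real N * (max 0 (gap X E x D R))\<^sup>2 / (2 * \<mu>)"
proof -
  define g where "g = max 0 (gap X E x D R)"
  define a where "a i = marginal i (x i) - marginal R (x R)" for i
  have term_le: "E i (y i) - E i (x i) - marginal R (x R) * (y i - x i) \<le> g\<^sup>2 / (2 * \<mu>)"
    if i: "i < N" for i
  proof -
    have upper: "E i (y i) - E i (x i) - marginal R (x R) * (y i - x i)
        \<le> a i * (y i - x i) - \<mu> / 2 * (y i - x i)\<^sup>2"
      using pool_upper_quadratic[OF i feasible_in_domain[OF x i] feasible_in_domain[OF y i]]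
      by (simp add: a_def algebra_simps)
    have a_nonpos: "a i \<le> 0"
      using receiver_marginal_ge[OF x R i] by (simp add: a_def)
    show ?thesis
    proof (cases "0 < x i")
      case True
      \<comment> \<open>The marginal of an active pool lies between those of donor and
        receiver.\<close>
      then have "\<bar>a i\<bar> \<le> g"
        using donor_marginal_le[OF x D i True] a_nonpos by (simp add: a_def g_def gap_def)
      then show ?thesis
        by (rule order_trans[OF upper linear_minus_quadratic_le])
    next
      case False
      \<comment> \<open>An empty pool may have a marginal below the donor's, but it can only be
        filled, so its linear term has the favourable sign.\<close>
      then have "x i = 0" "0 \<le> y i"
        using x y i by (auto simp: feasible_def not_less intro: antisym)
      then have "a i * (y i - x i) \<le> 0"
        using a_nonpos by (simp add: mult_nonpos_nonneg)
      moreover have "0 \<le> \<mu> / 2 * (y i - x i)\<^sup>2" "0 \<le> g\<^sup>2 / (2 * \<mu>)"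
        using mu_pos by simp_all
      ultimately show ?thesis
        using upper by linarith
    qed
  qed
  have "(\<Sum>i<N. E i (y i) - E i (x i) - marginal R (x R) * (y i - x i))
      = objective N E y - objective N E x - marginal R (x R) * ((\<Sum>i<N. y i) - (\<Sum>i<N. x i))"
    by (simp add: objective_def sum_subtractf sum_distrib_left right_diff_distrib)
  also have "\<dots> = objective N E y - objective N E x"
    using x y by (simp add: feasible_def)
  finally show ?thesis
    using sum_mono[of "{..<N}" "\<lambda>i. E i (y i) - E i (x i) - marginal R (x R) * (y i - x i)"
        "\<lambda>i. g\<^sup>2 / (2 * \<mu>)"] term_le
    by (simp add: g_def)
qed

section \<open>The greedy invariant\<close>

text \<open>The right-hand side is taken at \<open>0\<close> because that is the marginal a donor
  would have after giving away everything.\<close>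

definition greedy_state :: "(nat \<Rightarrow> real) \<Rightarrow> bool" where
  "greedy_state x \<longleftrightarrow>
     (\<forall>i<N. \<forall>j<N. 0 < x i \<longrightarrow> marginal j (x j) \<le> marginal i 0)"

text \<open>Portions only lower marginals, and the pool that receives one had the largest marginal,
  itself at most its initial one. The bound on the total keeps all points in the domain; it passes
  to earlier stages because portions are positive.\<close>

lemma greedy_partial_state:
  assumes "greedy_partial N X E x" "(\<Sum>i<N. x i) \<le> X"
  shows "(\<forall>i<N. 0 \<le> x i) \<and> greedy_state x"
  using assms
proof (induction rule: greedy_partial.induct)
  case zero
  show ?case
    by (simp add: greedy_state_def)
next
  case (portion x i \<delta>)
  have i: "i < N" and best: "\<And>j. j < N \<Longrightarrow> marginal j (x j) \<le> marginal i (x i)"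
    using portion.hyps(2) by (auto simp: is_arg_max_def not_less[symmetric])
  have "(\<Sum>j<N. (x(i := x i + \<delta>)) j) = (\<Sum>j<N. x j + (if j = i then \<delta> else 0))"
    by (intro sum.cong) auto
  also have "\<dots> = (\<Sum>j<N. x j) + \<delta>"
    using i by (simp add: sum.distrib)
  finally have total: "(\<Sum>j<N. x j) + \<delta> \<le> X"
    using portion.prems by simp
  then have nonneg: "\<forall>j<N. 0 \<le> x j" and state: "greedy_state x"
    using portion.IH portion.hyps(3) by auto
  have "x i \<le> (\<Sum>j<N. x j)"
    using nonneg i by (intro member_le_sum) auto
  then have le_X: "x i + \<delta> \<le> X"
    using total by linarith
  have drop: "marginal j ((x(i := x i + \<delta>)) j) \<le> marginal j (x j)" if "j < N" for j
    using marginal_antimono[OF i, of "x i" "x i + \<delta>"] nonneg i le_X portion.hyps(3) by auto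
  have start: "marginal i (x i) \<le> marginal i 0"
    using marginal_antimono[OF i, of 0 "x i"] nonneg i le_X portion.hyps(3) by auto
  have "marginal j ((x(i := x i + \<delta>)) j) \<le> marginal k 0"
    if "k < N" "j < N" "0 < (x(i := x i + \<delta>)) k" for k j
  proof (cases "k = i")
    case True
    then show ?thesis
      using drop[OF that(2)] best[OF that(2)] start by simp
  next
    case False
    then have "marginal j (x j) \<le> marginal k 0"
      using state that by (auto simp: greedy_state_def)
    then show ?thesis
      using drop[OF that(2)] by linarith
  qed
  then show ?case
    using nonneg portion.hyps(3) by (auto simp: greedy_state_def intro: add_nonneg_nonneg)
qed

lemma greedy_initialization_state:
  assumes "greedy_initialization N X E x"
  shows "feasible N X x" "greedy_state x"
  using assms greedy_partial_state by (auto simp: greedy_initialization_def feasible_def)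

section \<open>Effect of a single transfer\<close>

text \<open>
  The amount \<open>s = g / (4L)\<close> is at most \<open>\<delta>\<close>; up to \<open>s\<close> the quadratic lower bounds give the
  gain, and from \<open>s\<close> to \<open>\<delta>\<close> nothing is lost because the amount \<open>\<delta>\<close> is legitimate.
\<close>

lemma transfer_gain:
  assumes D: "D < N" and R: "R < N"
    and bounds: "0 \<le> d" "0 \<le> r" "0 < \<delta>" "2 * \<delta> \<le> d" "r + d \<le> X"
    and g: "g = marginal R r - marginal D d" "0 < g"
    and legit: "marginal D (d - \<delta>) \<le> marginal R (r + \<delta>)"
    and overshoot: "marginal R (r + 2 * \<delta>) \<le> marginal D (d - 2 * \<delta>)"
  shows "E D d + E R r + 3 * g\<^sup>2 / (16 * L) \<le> E D (d - \<delta>) + E R (r + \<delta>)"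
proof -
  define s where "s = g / (4 * L)"
  \<comment> \<open>Moving \<open>2 * \<delta>\<close> closes or reverses the gap, while each of the
    two marginals changes by at most \<open>2 * L * \<delta>\<close>.\<close>
  have "g \<le> 4 * L * \<delta>"
    using marginal_decrease(2)[OF R, of r "r + 2 * \<delta>"]
      marginal_decrease(2)[OF D, of "d - 2 * \<delta>" d] bounds g(1) overshoot
    by simp
  then have s: "0 \<le> s" "s \<le> \<delta>"
    using L_pos g(2) by (simp_all add: s_def field_simps)
  have gain: "g * s - L * s\<^sup>2 = 3 * g\<^sup>2 / (16 * L)"
    using L_pos by (simp add: s_def power2_eq_square field_simps)
  have "E R r + marginal R r * s - L / 2 * s\<^sup>2 \<le> E R (r + s)"
    using pool_lower_quadratic[OF R, of r "r + s"] bounds s by simp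
  moreover have "E D d - marginal D d * s - L / 2 * s\<^sup>2 \<le> E D (d - s)"
    using pool_lower_quadratic[OF D, of d "d - s"] bounds s by simp
  moreover have "g * s = marginal R r * s - marginal D d * s"
    by (simp add: g(1) left_diff_distrib)
  ultimately have first: "E D d + E R r + 3 * g\<^sup>2 / (16 * L) \<le> E D (d - s) + E R (r + s)"
    using gain by (simp add: field_simps)
  have "E R (r + s) \<le> E R (r + \<delta>) + marginal R (r + \<delta>) * (s - \<delta>)"
    using pool_upper_linear[OF R, of "r + \<delta>" "r + s"] bounds s by simp
  moreover have "E D (d - s) \<le> E D (d - \<delta>) + marginal D (d - \<delta>) * (\<delta> - s)"
    using pool_upper_linear[OF D, of "d - \<delta>" "d - s"] bounds s by simp
  moreover have "marginal D (d - \<delta>) * (\<delta> - s) \<le> marginal R (r + \<delta>) * (\<delta> - s)"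
    using legit s by (intro mult_right_mono) auto
  moreover have "marginal R (r + \<delta>) * (s - \<delta>) = - (marginal R (r + \<delta>) * (\<delta> - s))"
    by (simp add: algebra_simps)
  ultimately show ?thesis
    using first by linarith
qed

lemma sum_remove_two:
  fixes f :: "nat \<Rightarrow> real"
  assumes "D < N" "R < N" "D \<noteq> R"
  shows "(\<Sum>i<N. f i) = f D + f R + (\<Sum>i\<in>{..<N} - {D} - {R}. f i)"
  using assms sum.remove[of "{..<N}" D f] sum.remove[of "{..<N} - {D}" R f] by simp

text \<open>The amount \<open>2 * \<delta>\<close> is either the previous, rejected candidate or the
  whole holding of the donor, which the halving never tests. The greedy invariant settles the second
  case and gives only a non-strict inequality.\<close>

lemma halving_overshoots:
  assumes x: "feasible N X x" and state: "greedy_state x"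
    and D: "D < N" "0 < x D" and R: "R < N" and "D \<noteq> R"
    and halving: "halving_amount X E x D R \<delta>"
  shows "0 < \<delta>" "2 * \<delta> \<le> x D"
    and "marginal D (x D - \<delta>) \<le> marginal R (x R + \<delta>)"
    and "marginal R (x R + 2 * \<delta>) \<le> marginal D (x D - 2 * \<delta>)"
proof -
  have total: "x R + x D \<le> X"
    using feasible_add_le[OF x R D(1)] \<open>D \<noteq> R\<close> by simp
  have R_nonneg: "0 \<le> x R"
    using x R by (simp add: feasible_def)
  have legit_iff: "legitimate X E x D R t \<longleftrightarrow> marginal D (x D - t) \<le> marginal R (x R + t)"
    if "0 \<le> t" "t \<le> x D" for t
    unfolding legitimate_def
    using that total R_nonneg by (intro price_le_iff R D(1)) auto
  obtain m where m: "1 \<le> m" "\<delta> = x D / 2 ^ m" "legitimate X E x D R \<delta>"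
    and earlier: "\<And>j. 1 \<le> j \<Longrightarrow> j < m \<Longrightarrow> \<not> legitimate X E x D R (x D / 2 ^ j)"
    using halving by (auto simp: halving_amount_def)
  \<comment> \<open>The exponent \<open>n\<close> belongs to the doubled amount;
    \<open>n = 0\<close> means the whole holding.\<close>
  obtain n where n: "m = Suc n"
    using m(1) by (cases m) auto
  have double: "2 * \<delta> = x D / 2 ^ n"
    by (simp add: m(2) n)
  show pos: "0 < \<delta>"
    using D(2) by (simp add: m(2))
  have "x D * 1 \<le> x D * 2 ^ n"
    using D(2) by (intro mult_left_mono) auto
  then show le: "2 * \<delta> \<le> x D"
    unfolding double by (simp add: divide_le_eq)
  show "marginal D (x D - \<delta>) \<le> marginal R (x R + \<delta>)"
    using legit_iff[of \<delta>] m(3) pos le by simp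
  show "marginal R (x R + 2 * \<delta>) \<le> marginal D (x D - 2 * \<delta>)"
  proof (cases "n = 0")
    case True
    then have "2 * \<delta> = x D"
      using double by simp
    moreover have "marginal R (x R) \<le> marginal D 0"
      using state D R by (simp add: greedy_state_def)
    moreover have "marginal R (x R + x D) \<le> marginal R (x R)"
      using marginal_antimono[OF R R_nonneg, of "x R + x D"] total D(2) by simp
    ultimately show ?thesis
      by simp
  next
    case False
    then have "\<not> legitimate X E x D R (2 * \<delta>)"
      using earlier[of n] n by (simp add: double)
    then show ?thesis
      using legit_iff[of "2 * \<delta>"] pos le by simp
  qed
qed

section \<open>Invariance and contraction for one round\<close>

lemma transfer_round_step:
  assumes x: "feasible N X x" and state: "greedy_state x"
    and D: "is_donor N X E x D" and R: "is_receiver N X E x R"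
    and pos: "0 < gap X E x D R" and halving: "halving_amount X E x D R \<delta>"
  shows "feasible N X (transfer x D R \<delta>)"
    and "greedy_state (transfer x D R \<delta>)"
    and "objective N E x + 3 * (gap X E x D R)\<^sup>2 / (16 * L) \<le> objective N E (transfer x D R \<delta>)"
proof -
  have DN: "D < N" "0 < x D" and RN: "R < N"
    using D R by (auto simp: is_donor_def is_arg_max_def is_receiver_def is_arg_min_def)
  have neq: "D \<noteq> R"
    using pos by (auto simp: gap_def)
  have R_nonneg: "0 \<le> x R"
    using x RN by (simp add: feasible_def)
  have total: "x R + x D \<le> X"
    using feasible_add_le[OF x RN DN(1)] neq by simp
  note amount = halving_overshoots[OF x state DN RN neq halving]
  define x' where "x' = transfer x D R \<delta>"
  have x'_D: "x' D = x D - \<delta>" and x'_R: "x' R = x R + \<delta>"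
    and x'_other: "\<And>i. i \<noteq> D \<Longrightarrow> i \<noteq> R \<Longrightarrow> x' i = x i"
    using neq by (simp_all add: x'_def transfer_def)
  have "(\<Sum>i<N. x' i) = (\<Sum>i<N. x i)"
    using sum_remove_two[OF DN(1) RN neq] by (simp add: x'_D x'_R x'_other)
  moreover have "0 \<le> x' i" if "i < N" for i
    using that x amount(1,2) R_nonneg
    by (cases "i = D"; cases "i = R") (auto simp: feasible_def x'_D x'_R x'_other)
  ultimately show "feasible N X (transfer x D R \<delta>)"
    using x by (simp add: feasible_def x'_def)
  have R_drop: "marginal R (x R + \<delta>) \<le> marginal R (x R)"
    using marginal_antimono[OF RN R_nonneg, of "x R + \<delta>"] amount(1,2) total by simp
  \<comment> \<open>The receiver's old marginal bounds all new ones; for the donor this is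
    legitimacy followed by the drop at the receiver.\<close>
  have drop: "marginal j (x' j) \<le> marginal R (x R)" if "j < N" for j
  proof (cases "j = D \<or> j = R")
    case True
    then show ?thesis
      using R_drop amount(3) by (auto simp: x'_D x'_R)
  next
    case False
    then show ?thesis
      using receiver_marginal_ge[OF x R that] by (simp add: x'_other)
  qed
  \<comment> \<open>Only the receiver can become newly active, and its initial marginal dominates
    its current one.\<close>
  have start: "marginal R (x R) \<le> marginal i 0" if "i < N" "0 < x' i" for i
  proof (cases "i = R")
    case True
    then show ?thesis
      using marginal_antimono[OF RN order_refl R_nonneg] total DN(2) by simp
  next
    case False
    then have "0 < x i"
      using that(2) DN(2) by (cases "i = D") (auto simp: x'_other)
    then show ?thesis
      using state that(1) RN by (simp add: greedy_state_def)
  qed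
  show "greedy_state (transfer x D R \<delta>)"
    using drop start unfolding greedy_state_def x'_def[symmetric] by (meson order_trans)
  have "E D (x D) + E R (x R) + 3 * (gap X E x D R)\<^sup>2 / (16 * L) \<le> E D (x D - \<delta>) + E R (x R + \<delta>)"
    using DN(2) R_nonneg amount total pos
    by (intro transfer_gain DN(1) RN) (auto simp: gap_def)
  then show "objective N E x + 3 * (gap X E x D R)\<^sup>2 / (16 * L) \<le> objective N E (transfer x D R \<delta>)"
    using sum_remove_two[OF DN(1) RN neq, of "\<lambda>i. E i (x i)"]
      sum_remove_two[OF DN(1) RN neq, of "\<lambda>i. E i (x' i)"]
    unfolding objective_def x'_def[symmetric] by (simp add: x'_D x'_R x'_other)
qed

lemma transfer_round_invariant:
  assumes "feasible N X x" "greedy_state x" "transfer_round N X E x x'"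
  shows "feasible N X x'" "greedy_state x'"
  using assms transfer_round_step(1,2)
  by (auto simp: transfer_round_def split: if_splits)

lemma transfer_round_contraction:
  assumes x: "feasible N X x" and state: "greedy_state x"
    and round: "transfer_round N X E x x'" and y: "is_arg_max (objective N E) (feasible N X) y"
  shows "objective N E y - objective N E x'
    \<le> (1 - 3 / (32 * (L / \<mu>) * real N)) * (objective N E y - objective N E x)"
proof -
  define h where "h = objective N E y - objective N E x"
  have y_feasible: "feasible N X y" and h_nonneg: "0 \<le> h"
    using y x by (auto simp: is_arg_max_def h_def not_less)
  obtain D R where D: "is_donor N X E x D" and R: "is_receiver N X E x R"
    and step: "if 0 < gap X E x D R
         then \<exists>\<delta>. halving_amount X E x D R \<delta> \<and> x' = transfer x D R \<delta> else x' = x"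
    using round by (auto simp: transfer_round_def)
  define g where "g = max 0 (gap X E x D R)"
  have h_le: "h \<le> real N * g\<^sup>2 / (2 * \<mu>)"
    using objective_diff_le_gap[OF x y_feasible D R] by (simp add: h_def g_def)
  have N_pos: "0 < real N"
    using D by (auto simp: is_donor_def is_arg_max_def)
  have gain: "objective N E x + 3 * g\<^sup>2 / (16 * L) \<le> objective N E x'"
  proof (cases "0 < gap X E x D R")
    case True
    then show ?thesis
      using step transfer_round_step(3)[OF x state D R True] by (auto simp: g_def)
  next
    case False
    then show ?thesis
      using step by (simp add: g_def)
  qed
  have "3 / (32 * (L / \<mu>) * real N) * h \<le> 3 / (32 * (L / \<mu>) * real N) * (real N * g\<^sup>2 / (2 * \<mu>))"
    using h_le L_pos mu_pos by (intro mult_left_mono) auto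
  also have "\<dots> = 3 * g\<^sup>2 / (64 * L)"
    using L_pos mu_pos N_pos by (simp add: field_simps)
  \<comment> \<open>The gain and the gap bound would give the rate
    \<open>3 / (8 * (L / \<mu>) * real N)\<close>; a factor of four is given up here to reach the
    stated constant.\<close>
  also have "\<dots> \<le> 3 * g\<^sup>2 / (16 * L)"
    using L_pos by (intro divide_left_mono) auto
  finally show ?thesis
    using gain unfolding h_def by (simp add: left_diff_distrib)
qed

end

section \<open>Geometric decay and the number of rounds\<close>

lemma geometric_decay:
  fixes h :: "nat \<Rightarrow> real"
  assumes "\<And>k. h (Suc k) \<le> q * h k" "0 \<le> q"
  shows "h k \<le> q ^ k * h 0"
proof (induction k)
  case (Suc k)
  have "h (Suc k) \<le> q * (q ^ k * h 0)"
    using assms(1)[of k] mult_left_mono[OF Suc assms(2)] by linarith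
  then show ?case
    by (simp add: mult.assoc)
qed simp

text \<open>Since \<open>1 - 1 / c\<close> is at most \<open>exp (- (1 / c))\<close>, it suffices
  that \<open>k / c\<close> is at least \<open>ln a + ln (1 / \<epsilon>)\<close> for positive
  \<open>a\<close>. Replacing \<open>a\<close> by \<open>max 1 a\<close> also covers
  \<open>a = 0\<close> and keeps the logarithm nonnegative.\<close>

lemma geometric_decay_below:
  fixes a c \<epsilon> :: real
  assumes "0 < c" "1 / c \<le> 1" "0 < \<epsilon>" "\<epsilon> \<le> 1 / 2" "0 \<le> a"
    and k: "real k \<ge> (1 + ln (max 1 a) / ln 2) * c * ln (1 / \<epsilon>)"
  shows "(1 - 1 / c) ^ k * a \<le> \<epsilon>"
proof -
  define b where "b = max 1 a"
  have b: "1 \<le> b" "a \<le> b"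
    by (auto simp: b_def)
  \<comment> \<open>Here \<epsilon> being at most one half lets the additive term
    \<open>ln b\<close> be absorbed into a multiple of \<open>ln (1 / \<epsilon>)\<close>.\<close>
  have "ln 2 \<le> ln (1 / \<epsilon>)"
    using assms(3,4) by (subst ln_le_cancel_iff) (auto simp: field_simps)
  then have "ln b / ln 2 * ln 2 \<le> ln b / ln 2 * ln (1 / \<epsilon>)"
    using b(1) by (intro mult_left_mono) auto
  then have "ln b + ln (1 / \<epsilon>) \<le> (1 + ln b / ln 2) * ln (1 / \<epsilon>)"
    by (simp add: distrib_right)
  also have "\<dots> \<le> real k / c"
    using k assms(1) by (simp add: b_def[symmetric] field_simps)
  finally have exponent: "- (real k / c) + ln b \<le> ln \<epsilon>"
    using assms(3) by (simp add: ln_div)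
  have "1 - 1 / c \<le> exp (- (1 / c))"
    using exp_ge_add_one_self[of "- (1 / c)"] by simp
  then have "(1 - 1 / c) ^ k \<le> exp (- (1 / c)) ^ k"
    using assms(2) by (intro power_mono) auto
  also have "\<dots> = exp (- (real k / c))"
    by (simp add: exp_of_nat_mult[symmetric])
  finally have "(1 - 1 / c) ^ k * a \<le> exp (- (real k / c)) * b"
    using b assms(5) by (intro mult_mono) auto
  also have "\<dots> = exp (- (real k / c) + ln b)"
    using b(1) by (simp only: exp_add exp_ln)
  also have "\<dots> \<le> exp (ln \<epsilon>)"
    using exponent by simp
  finally show ?thesis
    using assms(3) by simp
qed

theorem theorem1:
  shows "\<exists>C :: real \<Rightarrow> real.
    \<forall>(N :: nat) (X :: real) (E :: nat \<Rightarrow> real \<Rightarrow> real) (\<mu> :: real) (L :: real) (\<kappa> :: real)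
      (xopt :: nat \<Rightarrow> real) (x :: nat \<Rightarrow> nat \<Rightarrow> real) (h :: nat \<Rightarrow> real).
      1 \<le> N \<longrightarrow>
      0 < X \<longrightarrow>
      (\<forall>i<N. trading_function X (E i)) \<longrightarrow>
      0 < \<mu> \<longrightarrow> \<mu> \<le> L \<longrightarrow>
      (\<forall>i<N. \<forall>t\<in>{0..X}. \<mu> \<le> - deriv2_on X (E i) t \<and> - deriv2_on X (E i) t \<le> L) \<longrightarrow>
      \<kappa> = L / \<mu> \<longrightarrow>
      is_arg_max (objective N E) (feasible N X) xopt \<longrightarrow>
      greedy_initialization N X E (x 0) \<longrightarrow>
      (\<forall>k. transfer_round N X E (x k) (x (Suc k))) \<longrightarrow>
      h = objective_gap N E xopt x \<longrightarrow>
        (\<forall>k. h (k + 1) \<le> (1 - 3 / (32 * \<kappa> * real N)) ^ (k + 1) * h 0) \<and>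
        (\<forall>\<epsilon>. 0 < \<epsilon> \<and> \<epsilon> \<le> 1 / 2 \<longrightarrow>
          (\<forall>k. real k \<ge> C (h 0) * real N * \<kappa> * ln (1 / \<epsilon>) \<longrightarrow> h k \<le> \<epsilon>))"
\<comment> \<open>The factor \<open>32 / 3\<close> comes from the inverse contraction rate
  \<open>c\<close> below, the rest from \<open>geometric_decay_below\<close> at the initial
  objective gap.\<close>
proof (intro exI[of _ "\<lambda>a. 32 / 3 * (1 + ln (max 1 a) / ln 2)"] allI impI)
  fix N :: nat and X :: real and E :: "nat \<Rightarrow> real \<Rightarrow> real" and \<mu> L \<kappa> :: real
    and xopt :: "nat \<Rightarrow> real" and x :: "nat \<Rightarrow> nat \<Rightarrow> real" and h :: "nat \<Rightarrow> real"
  assume N: "1 \<le> N" and trading: "\<forall>i<N. trading_function X (E i)"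
    and \<mu>: "0 < \<mu>" "\<mu> \<le> L"
    and curvature: "\<forall>i<N. \<forall>t\<in>{0..X}. \<mu> \<le> - deriv2_on X (E i) t \<and> - deriv2_on X (E i) t \<le> L"
    and \<kappa>: "\<kappa> = L / \<mu>" and opt: "is_arg_max (objective N E) (feasible N X) xopt"
    and init: "greedy_initialization N X E (x 0)"
    and rounds: "\<forall>k. transfer_round N X E (x k) (x (Suc k))"
    and h: "h = objective_gap N E xopt x"
  interpret curved_pools N X E \<mu> L
    using trading \<mu> curvature by unfold_locales auto
  define c where "c = 32 * \<kappa> * real N / 3"
  have "1 \<le> \<kappa>"
    using \<mu> by (simp add: \<kappa>)
  \<comment> \<open>This gives \<open>c\<close> at least \<open>32 / 3\<close>, so the contraction
    factor is nonnegative and can be iterated.\<close>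
  then have "1 * 1 \<le> \<kappa> * real N"
    using N by (intro mult_mono) auto
  then have c: "0 < c" "1 / c \<le> 1" "1 - 3 / (32 * \<kappa> * real N) = 1 - 1 / c"
    by (auto simp: c_def)
  have invariant: "feasible N X (x k) \<and> greedy_state (x k)" for k
    using greedy_initialization_state[OF init] transfer_round_invariant rounds
    by (induction k) blast+
  have h_nonneg: "0 \<le> h k" for k
    using opt invariant[of k] by (auto simp: h objective_gap_def is_arg_max_def not_less)
  have "h (Suc k) \<le> (1 - 1 / c) * h k" for k
    using transfer_round_contraction[of "x k" "x (Suc k)" xopt] invariant[of k] rounds opt
    by (simp add: h objective_gap_def c(3)[symmetric] \<kappa>)
  then have decay: "h k \<le> (1 - 1 / c) ^ k * h 0" for k
    using c(2) by (intro geometric_decay) auto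
  have "h k \<le> \<epsilon>" if "0 < \<epsilon>" "\<epsilon> \<le> 1 / 2"
    "real k \<ge> 32 / 3 * (1 + ln (max 1 (h 0)) / ln 2) * real N * \<kappa> * ln (1 / \<epsilon>)" for \<epsilon> k
  proof -
    have "32 / 3 * (1 + ln (max 1 (h 0)) / ln 2) * real N * \<kappa> * ln (1 / \<epsilon>)
        = (1 + ln (max 1 (h 0)) / ln 2) * c * ln (1 / \<epsilon>)"
      by (simp add: c_def)
    then have "(1 - 1 / c) ^ k * h 0 \<le> \<epsilon>"
      using geometric_decay_below[OF c(1,2) that(1,2) h_nonneg[of 0], of k] that(3) by argo
    then show ?thesis
      using decay[of k] by linarith
  qed
  then show "(\<forall>k. h (k + 1) \<le> (1 - 3 / (32 * \<kappa> * real N)) ^ (k + 1) * h 0) \<and>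
      (\<forall>\<epsilon>. 0 < \<epsilon> \<and> \<epsilon> \<le> 1 / 2 \<longrightarrow>
        (\<forall>k. real k \<ge> 32 / 3 * (1 + ln (max 1 (h 0)) / ln 2) * real N * \<kappa> * ln (1 / \<epsilon>) \<longrightarrow> h k \<le> \<epsilon>))"
    unfolding c(3) using decay by blast
qed

end
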